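(* Every finite simple graph $G=(V,E)$ with minimum degree $\delta\geq 10^6$ can be decomposed into two $\{1,2\}$-weight colourable subgraphs; that is, $E$ can be partitioned into $E_1$ and $E_2$ such that for each $i\in\{1,2\}$ the graph $G_i=(V,E_i)$ is $\{1,2\}$-weight colourable.
   Context: A graph $F=(V,E)$ is $\{1,2\}$-weight colourable if there is a function $c:E\to\{1,2\}$ such that, writing $d_c(v):=\sum_{u\in N_F(v)}c(uv)$ for the weighted degree of $v$ in $F$, we have $d_c(u)\neq d_c(v)$ for every edge $uv\in E$. *)

theory Defs
  imports Main
begin

definition simple_graph :: "'a set \<Rightarrow> 'a set set \<Rightarrow> bool" where
  "simple_graph V E \<longleftrightarrow> finite V \<and> (\<forall>e\<in>E. e \<subseteq> V \<and> card e = 2)"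

definition degree :: "'a set set \<Rightarrow> 'a \<Rightarrow> nat" where
  "degree E v = card {e\<in>E. v \<in> e}"

definition weighted_degree :: "'a set set \<Rightarrow> ('a set \<Rightarrow> nat) \<Rightarrow> 'a \<Rightarrow> nat" where
  "weighted_degree E c v = (\<Sum>e\<in>{e\<in>E. v \<in> e}. c e)"

definition weight_colourable_12 :: "'a set \<Rightarrow> 'a set set \<Rightarrow> bool" where
  "weight_colourable_12 V E \<longleftrightarrow>
     (\<exists>c :: 'a set \<Rightarrow> nat. (\<forall>e\<in>E. c e \<in> {1, 2}) \<and>
        (\<forall>u v. {u, v} \<in> E \<longrightarrow> weighted_degree E c u \<noteq> weighted_degree E c v))"

end

theory Submission
  imports Defs "HOL-Number_Theory.Cong"
begin

text \<open>
  Weighting the edges of a subgraph H of G by 2 and the others by 1 gives v the weighted degree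
  \<open>deg\<^sub>G v + deg\<^sub>H v\<close>. By a theorem of Addario-Berry, Dalal and Reed, H can be chosen so that
  \<open>deg\<^sub>H v\<close> lies in one of two prescribed pairs of consecutive integers around \<open>deg\<^sub>G v / 2\<close>; hence
  \<open>\<lfloor>(deg\<^sub>G v + deg\<^sub>H v) / 2\<rfloor>\<close> can be given any residue modulo \<open>k v\<close>, as long as \<open>8 k v \<le> deg\<^sub>G v\<close>.

  Let \<open>k v\<close> be the power of two between \<open>deg v / 64\<close> and \<open>deg v / 32\<close>, and give every vertex two
  labels \<open>r v\<close>, \<open>s v\<close> modulo \<open>k v\<close>. There are so many pairs of labels that an assignment minimising
  a weighted count of the conflicts has no edge on which both labels conflict, and only boundedly
  many conflicting edges at each vertex. Edges with an r-conflict go to the first part and edges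
  with an s-conflict to the second one, the remaining edges are halved, and the residues of the
  weighted degrees are prescribed by s in the first part and by r in the second.
\<close>

subsection \<open>Neighbourhoods and degrees\<close>

definition nbrs :: "'a set set \<Rightarrow> 'a \<Rightarrow> 'a set" where
  "nbrs E v = {u. {v, u} \<in> E}"

lemma nbrs_sym: "u \<in> nbrs E v \<longleftrightarrow> v \<in> nbrs E u"
  by (simp add: nbrs_def insert_commute)

lemma simple_graph_subset: "simple_graph V F \<Longrightarrow> H \<subseteq> F \<Longrightarrow> simple_graph V H"
  unfolding simple_graph_def by blast

lemma simple_graph_finite: "simple_graph V F \<Longrightarrow> finite F"
  unfolding simple_graph_def by (meson PowI finite_Pow_iff finite_subset subsetI)

lemma simple_graph_edgeE:
  assumes "simple_graph V F" "e \<in> F"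
  obtains u v where "e = {u, v}" "u \<noteq> v"
  using assms unfolding simple_graph_def by (meson card_2_iff)

lemma simple_graph_edgeD:
  "simple_graph V F \<Longrightarrow> {u, v} \<in> F \<Longrightarrow> u \<in> V \<and> v \<in> V \<and> u \<noteq> v"
  unfolding simple_graph_def by fastforce

lemma finite_nbrs: "simple_graph V F \<Longrightarrow> finite (nbrs F v)"
  using simple_graph_edgeD[of V F v] finite_subset[of "nbrs F v" V]
  by (auto simp: nbrs_def simple_graph_def)

lemma bij_betw_nbrs_incident_edges:
  assumes "simple_graph V F"
  shows "bij_betw (\<lambda>u. {v, u}) (nbrs F v) {e \<in> F. v \<in> e}"
proof (rule bij_betwI')
  fix e assume e: "e \<in> {e \<in> F. v \<in> e}"
  then obtain a b where "e = {a, b}" using simple_graph_edgeE[OF assms] by blast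
  then show "\<exists>u\<in>nbrs F v. e = {v, u}" using e by (auto simp: nbrs_def insert_commute)
qed (auto simp: nbrs_def doubleton_eq_iff)

lemma degree_eq_card_nbrs: "simple_graph V F \<Longrightarrow> degree F v = card (nbrs F v)"
  unfolding degree_def using bij_betw_same_card[OF bij_betw_nbrs_incident_edges] by (rule sym)

lemma sum_card_nbrs_swap:
  assumes "finite S" "finite T"
  shows "(\<Sum>v\<in>T. card (nbrs H v \<inter> S)) = (\<Sum>u\<in>S. card (nbrs H u \<inter> T))"
  using sum_multicount_gen[of T S "\<lambda>v u. u \<in> nbrs H v" "\<lambda>u. card (nbrs H u \<inter> T)"] assms
  by (simp add: nbrs_sym[of _ H] Int_def conj_commute)

lemma degree_mono: "finite F \<Longrightarrow> H \<subseteq> F \<Longrightarrow> degree H v \<le> degree F v"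
  unfolding degree_def by (intro card_mono) auto

lemma degree_Un_disjoint:
  assumes "finite A" "finite B" "A \<inter> B = {}"
  shows "degree (A \<union> B) v = degree A v + degree B v"
proof -
  have "{e \<in> A \<union> B. v \<in> e} = {e \<in> A. v \<in> e} \<union> {e \<in> B. v \<in> e}" by auto
  then show ?thesis unfolding degree_def using assms by (simp add: card_Un_disjoint disjoint_iff)
qed

lemma degree_Diff_add: "finite A \<Longrightarrow> B \<subseteq> A \<Longrightarrow> degree (A - B) v + degree B v = degree A v"
  using degree_Un_disjoint[of "A - B" B v] by (simp add: finite_subset Un_absorb2 Int_commute)

definition star :: "'a \<Rightarrow> 'a set \<Rightarrow> 'a set set" where
  "star u X = (\<lambda>x. {u, x}) ` X"

lemma mem_star_iff: "{a, b} \<in> star u X \<longleftrightarrow> a = u \<and> b \<in> X \<or> b = u \<and> a \<in> X"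
  by (auto simp: star_def doubleton_eq_iff)

lemma star_subset_iff: "star u X \<subseteq> F \<longleftrightarrow> X \<subseteq> nbrs F u"
  by (auto simp: star_def nbrs_def)

lemma degree_star:
  assumes "u \<notin> X"
  shows "degree (star u X) v = (if v = u then card X else of_bool (v \<in> X))"
proof -
  have "{e \<in> star u X. v \<in> e} = (\<lambda>x. {u, x}) ` (if v = u then X else X \<inter> {v})"
    by (auto simp: star_def)
  moreover have "inj_on (\<lambda>x. {u, x}) Y" for Y by (auto simp: inj_on_def doubleton_eq_iff)
  ultimately show ?thesis unfolding degree_def by (auto simp: card_image)
qed

subsection \<open>Subgraphs with degrees in prescribed windows\<close>

text \<open>
  Among all pairs of a subgraph H and a choice \<open>\<tau> v \<in> {lo v, hi v}\<close> with \<open>\<tau> v \<le> deg\<^sub>H v\<close>, minimise the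
  total excess of \<open>deg\<^sub>H v\<close> over \<open>\<tau> v + 1\<close>. If a vertex s has positive excess, follow the walks from s
  alternating between edges in H and outside H. Unless the excess can be pushed away along such
  a walk, the vertices at odd distance have degree exactly \<open>\<tau>\<close> and those at even distance at least
  \<open>\<tau> + 1\<close>. Counting the edges between these two sets yields a vertex at which the choice of \<open>\<tau>\<close> can
  be switched, which unblocks a walk.
\<close>

locale degree_windows =
  fixes V :: "'a set" and F :: "'a set set" and lo hi :: "'a \<Rightarrow> nat"
  assumes graph: "simple_graph V F"
    and lo_less_hi: "v \<in> V \<Longrightarrow> lo v < hi v"
    and lo_le_half: "v \<in> V \<Longrightarrow> 2 * lo v \<le> degree F v"
    and half_le_hi: "v \<in> V \<Longrightarrow> degree F v \<le> 2 * hi v + 1"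
    and gap_le_lo: "v \<in> V \<Longrightarrow> hi v - lo v \<le> lo v"
    and gap_le_codegree: "v \<in> V \<Longrightarrow> 2 * hi v \<le> degree F v + lo v"
begin

definition valid :: "'a set set \<Rightarrow> ('a \<Rightarrow> nat) \<Rightarrow> bool" where
  "valid H \<tau> \<longleftrightarrow> H \<subseteq> F \<and> (\<forall>v\<in>V. \<tau> v \<in> {lo v, hi v} \<and> \<tau> v \<le> degree H v)"

definition excess :: "'a set set \<Rightarrow> ('a \<Rightarrow> nat) \<Rightarrow> 'a \<Rightarrow> nat" where
  "excess H \<tau> v = degree H v - (\<tau> v + 1)"

definition optimal :: "'a set set \<Rightarrow> ('a \<Rightarrow> nat) \<Rightarrow> bool" where
  "optimal H \<tau> \<longleftrightarrow> valid H \<tau> \<and>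
     (\<forall>H' \<tau>'. valid H' \<tau>' \<longrightarrow> (\<Sum>v\<in>V. excess H \<tau> v) \<le> (\<Sum>v\<in>V. excess H' \<tau>' v))"

text \<open>
  Walks leave the vertices of even layers (flag \<open>True\<close>) along H and those of odd layers along
  \<open>F - H\<close>.
\<close>

definition walk_edges :: "'a set set \<Rightarrow> bool \<Rightarrow> 'a set set" where
  "walk_edges H b = (if b then H else F - H)"

fun layer :: "'a set set \<Rightarrow> 'a \<Rightarrow> nat \<Rightarrow> 'a set" where
  "layer H s 0 = {s}"
| "layer H s (Suc n) = (\<Union>x\<in>layer H s n. nbrs (walk_edges H (even n)) x)"

definition reach :: "'a set set \<Rightarrow> 'a \<Rightarrow> bool \<Rightarrow> 'a set" where
  "reach H s b = (\<Union>n\<in>{n. even n = b}. layer H s n)"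

definition blocked :: "'a set set \<Rightarrow> ('a \<Rightarrow> nat) \<Rightarrow> bool \<Rightarrow> 'a \<Rightarrow> bool" where
  "blocked H \<tau> b v \<longleftrightarrow> (if b then \<tau> v < degree H v else degree H v = \<tau> v)"

definition flip :: "'a set set \<Rightarrow> bool \<Rightarrow> 'a set set \<Rightarrow> 'a set set" where
  "flip H b K = (if b then H - K else H \<union> K)"

lemma finite_V: "finite V"
  using graph by (simp add: simple_graph_def)

lemma valid_subset: "valid H \<tau> \<Longrightarrow> H \<subseteq> F"
  by (simp add: valid_def)

lemma walk_edges_subset: "H \<subseteq> F \<Longrightarrow> walk_edges H b \<subseteq> F"
  by (auto simp: walk_edges_def)

lemma optimal_valid: "optimal H \<tau> \<Longrightarrow> valid H \<tau>"
  by (simp add: optimal_def)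

lemma optimal_transfer:
  assumes opt: "optimal H \<tau>" and val: "valid H' \<tau>'"
    and le: "\<And>v. v \<in> V \<Longrightarrow> excess H' \<tau>' v \<le> excess H \<tau> v"
  shows "optimal H' \<tau>'" and "v \<in> V \<Longrightarrow> excess H' \<tau>' v = excess H \<tau> v"
proof -
  have "(\<Sum>v\<in>V. excess H' \<tau>' v) \<le> (\<Sum>v\<in>V. excess H \<tau> v)" by (intro sum_mono le)
  then have eq: "(\<Sum>v\<in>V. excess H' \<tau>' v) = (\<Sum>v\<in>V. excess H \<tau> v)"
    using opt val by (simp add: optimal_def le_antisym)
  then show "optimal H' \<tau>'" using opt val by (simp add: optimal_def)
  show "excess H' \<tau>' v = excess H \<tau> v" if "v \<in> V"
    using sum_mono_inv[OF eq le that finite_V] .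
qed

lemma star_subset_graph:
  assumes "H \<subseteq> F" "X \<subseteq> nbrs (walk_edges H b) u"
  shows "star u X \<subseteq> F" "X \<subseteq> V" "u \<notin> X"
proof -
  have "star u X \<subseteq> walk_edges H b" using assms(2) by (simp add: star_subset_iff)
  then show "star u X \<subseteq> F" using walk_edges_subset[OF assms(1)] by blast
  then show "X \<subseteq> V" "u \<notin> X"
    using simple_graph_edgeD[OF graph] by (auto simp: star_subset_iff nbrs_def)
qed

lemma degree_flip_star:
  assumes "H \<subseteq> F" and X: "X \<subseteq> nbrs (walk_edges H b) u"
  shows "degree (flip H b (star u X)) v =
    (let change = if v = u then card X else of_bool (v \<in> X)
     in if b then degree H v - change else degree H v + change)"
proof -
  note star = star_subset_graph[OF assms]
  have "finite H" "finite (star u X)"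
    using assms(1) star(1) simple_graph_finite[OF graph] by (meson finite_subset)+
  moreover have "star u X \<subseteq> walk_edges H b" using X by (simp add: star_subset_iff)
  ultimately have "degree (flip H b (star u X)) v
      = (if b then degree H v - degree (star u X) v else degree H v + degree (star u X) v)"
    using degree_Diff_add[of H "star u X" v] degree_Un_disjoint[of H "star u X" v]
    by (cases b) (auto simp: flip_def walk_edges_def)
  then show ?thesis by (simp add: degree_star[OF star(3)] Let_def)
qed

text \<open>
  A walk using a flipped edge \<open>{u, x}\<close> leaves or enters the vertex x of X; the latter is impossible
  by the parity assumption, and the former does not happen before X is first met.
\<close>

lemma layer_flip_star_meets:
  assumes "x \<in> X" "x \<in> layer H s n" and X: "X \<subseteq> nbrs (walk_edges H (even n)) u"
    and parity: "\<And>i. i \<le> n \<Longrightarrow> even i \<noteq> even n \<Longrightarrow> layer H s i \<inter> X = {}"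
  obtains m y where "m \<le> n" "even m = even n" "y \<in> X" "y \<in> layer (flip H (even n) (star u X)) s m"
proof -
  let ?H = "flip H (even n) (star u X)"
  define meets where "meets m \<longleftrightarrow> even m = even n \<and> layer H s m \<inter> X \<noteq> {}" for m
  define m where "m = (LEAST m. meets m)"
  have "meets n" using assms by (auto simp: meets_def)
  then have m: "meets m" "m \<le> n" and first: "\<And>i. i < m \<Longrightarrow> \<not> meets i"
    unfolding m_def by (auto intro: LeastI Least_le dest: not_less_Least)
  have "layer H s i \<subseteq> layer ?H s i" if "i \<le> m" for i
    using that
  proof (induction i)
    case (Suc i)
    show ?case
    proof
      fix z assume "z \<in> layer H s (Suc i)"
      then obtain y where y: "y \<in> layer H s i" and yz: "{y, z} \<in> walk_edges H (even i)"
        by (auto simp: nbrs_def)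
      have "{y, z} \<in> walk_edges ?H (even i)"
      proof (cases "{y, z} \<in> star u X")
        case True
        then have "even i = even n"
          using X yz by (auto simp: walk_edges_def star_subset_iff[symmetric] split: if_splits)
        then have "y \<notin> X" "z \<notin> X"
          using first[of i] parity[of "Suc i"] y \<open>z \<in> layer H s (Suc i)\<close> Suc.prems m(2)
          by (auto simp: meets_def simp del: layer.simps)
        then show ?thesis using True by (simp add: mem_star_iff)
      next
        case False
        then show ?thesis using yz by (auto simp: walk_edges_def flip_def)
      qed
      then show "z \<in> layer ?H s (Suc i)" using y Suc by (auto simp: nbrs_def)
    qed
  qed simp
  then obtain y where "y \<in> X" "y \<in> layer ?H s m" using m by (auto simp: meets_def)
  then show ?thesis using m that by (auto simp: meets_def)
qed

definition layer_blocked :: "nat \<Rightarrow> bool" where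
  "layer_blocked n \<longleftrightarrow> (\<forall>H \<tau> s x. optimal H \<tau> \<longrightarrow> s \<in> V \<longrightarrow> 0 < excess H \<tau> s
     \<longrightarrow> x \<in> layer H s n \<longrightarrow> blocked H \<tau> (even n) x)"

lemma layer_blockedD:
  "layer_blocked n \<Longrightarrow> optimal H \<tau> \<Longrightarrow> s \<in> V \<Longrightarrow> 0 < excess H \<tau> s \<Longrightarrow> x \<in> layer H s n
    \<Longrightarrow> blocked H \<tau> (even n) x"
  by (simp add: layer_blocked_def)

lemma optimal_flip_star:
  assumes opt: "optimal H \<tau>"
    and X: "X \<subseteq> nbrs (walk_edges H b) u" and blocked: "\<And>x. x \<in> X \<Longrightarrow> blocked H \<tau> b x"
    and t: "t \<in> {lo u, hi u}" "t \<le> degree (flip H b (star u X)) u"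
    and excess_u: "degree (flip H b (star u X)) u - (t + 1) \<le> excess H \<tau> u"
  shows "optimal (flip H b (star u X)) (\<tau>(u := t))"
    and "v \<in> V \<Longrightarrow> excess (flip H b (star u X)) (\<tau>(u := t)) v = excess H \<tau> v"
proof -
  let ?H = "flip H b (star u X)" and ?\<tau> = "\<tau>(u := t)"
  have val: "valid H \<tau>" by (rule optimal_valid[OF opt])
  note HF = valid_subset[OF val]
  note deg = degree_flip_star[OF HF X]
  have "?H \<subseteq> F" using HF star_subset_graph(1)[OF HF X] by (auto simp: flip_def)
  moreover have "?\<tau> v \<in> {lo v, hi v} \<and> ?\<tau> v \<le> degree ?H v" if "v \<in> V" for v
    using val blocked[of v] t that by (cases "v = u") (auto simp: valid_def deg blocked_def)
  ultimately have "valid ?H ?\<tau>" by (simp add: valid_def)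
  moreover have "excess ?H ?\<tau> v \<le> excess H \<tau> v" for v
    using excess_u blocked[of v] by (cases "v = u") (auto simp: excess_def deg blocked_def)
  ultimately show "optimal ?H ?\<tau>" "v \<in> V \<Longrightarrow> excess ?H ?\<tau> v = excess H \<tau> v"
    using optimal_transfer[OF opt] by blast+
qed

text \<open>
  Flipping the edges from u to X and resetting \<open>\<tau> u\<close> to t moves the degrees in X by one, so that
  the vertices of X stop blocking the walks from s.
\<close>

lemma flip_star_unaffordable:
  assumes opt: "optimal H \<tau>" and s: "s \<in> V" "0 < excess H \<tau> s"
    and layers: "\<And>i. i \<le> n \<Longrightarrow> layer_blocked i"
    and x: "x \<in> X" "x \<in> layer H s n"
    and X: "X \<subseteq> nbrs (walk_edges H (even n)) u"
    and blocked: "\<And>y. y \<in> X \<Longrightarrow> blocked H \<tau> (even n) y"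
    and t: "t \<in> {lo u, hi u}" "t \<le> degree (flip H (even n) (star u X)) u"
  shows "excess H \<tau> u < degree (flip H (even n) (star u X)) u - (t + 1)"
proof (rule ccontr)
  let ?H = "flip H (even n) (star u X)" and ?\<tau> = "\<tau>(u := t)"
  assume "\<not> ?thesis"
  then have "degree ?H u - (t + 1) \<le> excess H \<tau> u" by simp
  note opt' = optimal_flip_star(1)[OF opt X blocked t this]
    and excess_eq = optimal_flip_star(2)[OF opt X blocked t this]
  have HF: "H \<subseteq> F" by (rule valid_subset[OF optimal_valid[OF opt]])
  have "layer H s i \<inter> X = {}" if "i \<le> n" "even i \<noteq> even n" for i
  proof -
    have "\<not> blocked H \<tau> (even n) y" if "y \<in> layer H s i" for y
      using layer_blockedD[OF layers[OF \<open>i \<le> n\<close>] opt s that] \<open>even i \<noteq> even n\<close>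
      by (auto simp: blocked_def split: if_splits)
    then show ?thesis using blocked by blast
  qed
  then obtain m y where y: "m \<le> n" "even m = even n" "y \<in> X" "y \<in> layer ?H s m"
    using layer_flip_star_meets[OF x X] by blast
  then have "blocked ?H ?\<tau> (even n) y"
    using layer_blockedD[OF layers[OF y(1)] opt' s(1) _ y(4)] s excess_eq by simp
  moreover have "y \<noteq> u" "excess ?H ?\<tau> y = excess H \<tau> y"
    using y(3) star_subset_graph[OF HF X] excess_eq by auto
  ultimately show False
    using blocked[OF y(3)] y(3) degree_flip_star[OF HF X, of y]
    by (auto simp: blocked_def excess_def split: if_splits)
qed

lemma all_layers_blocked: "layer_blocked n"
proof (induction n rule: less_induct)
  case (less n)
  have "blocked H \<tau> (even n) x"
    if opt: "optimal H \<tau>" and s: "s \<in> V" "0 < excess H \<tau> s" and x: "x \<in> layer H s n" for H \<tau> s x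
  proof (cases n)
    case 0
    then show ?thesis using s x by (simp add: blocked_def excess_def)
  next
    case (Suc m)
    have IH: "layer_blocked i" if "i \<le> m" for i using less Suc that by simp
    obtain y where y: "y \<in> layer H s m" "{y, x} \<in> walk_edges H (even m)"
      using x Suc by (auto simp: nbrs_def)
    have val: "valid H \<tau>" by (rule optimal_valid[OF opt])
    note HF = valid_subset[OF val]
    have xy: "{y} \<subseteq> nbrs (walk_edges H (even m)) x" using y by (simp add: nbrs_def insert_commute)
    have "x \<in> V" using y simple_graph_edgeD[OF graph] walk_edges_subset[OF HF] by blast
    then have \<tau>: "\<tau> x \<in> {lo x, hi x}" "\<tau> x \<le> degree H x" using val by (auto simp: valid_def)
    have deg: "degree (flip H (even m) (star x {y})) x
        = (if even m then degree H x - 1 else degree H x + 1)"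
      using degree_flip_star[OF HF xy] by simp
    show ?thesis
    proof (rule ccontr)
      assume not_blocked: "\<not> ?thesis"
      have "excess H \<tau> x < degree (flip H (even m) (star x {y})) x - (\<tau> x + 1)"
      proof (rule flip_star_unaffordable[OF opt s IH _ y(1) xy])
        show "blocked H \<tau> (even m) z" if "z \<in> {y}" for z
          using layer_blockedD[OF IH opt s] y that by simp
      qed (use \<tau> not_blocked Suc in \<open>auto simp: deg blocked_def\<close>)
      then show False using not_blocked \<tau> Suc by (auto simp: deg blocked_def excess_def split: if_splits)
    qed
  qed
  then show ?case unfolding layer_blocked_def by blast
qed

lemma reach_blocked:
  "optimal H \<tau> \<Longrightarrow> s \<in> V \<Longrightarrow> 0 < excess H \<tau> s \<Longrightarrow> v \<in> reach H s b \<Longrightarrow> blocked H \<tau> b v"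
  using layer_blockedD[OF all_layers_blocked] by (fastforce simp: reach_def)

lemma reach_closed: "v \<in> reach H s b \<Longrightarrow> nbrs (walk_edges H b) v \<subseteq> reach H s (\<not> b)"
proof
  fix x assume "v \<in> reach H s b" and x: "x \<in> nbrs (walk_edges H b) v"
  then obtain n where "even n = b" "v \<in> layer H s n" by (auto simp: reach_def)
  then show "x \<in> reach H s (\<not> b)"
    unfolding reach_def using x by (intro UN_I[of "Suc n"]) auto
qed

lemma reach_subset:
  assumes "H \<subseteq> F" "s \<in> V"
  shows "reach H s b \<subseteq> V"
proof -
  have "layer H s n \<subseteq> V" for n
  proof (cases n)
    case (Suc m)
    then show ?thesis
      using walk_edges_subset[OF assms(1)] simple_graph_edgeD[OF graph] by (fastforce simp: nbrs_def)
  qed (use assms in simp)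
  then show ?thesis by (auto simp: reach_def)
qed

lemma finite_reach: "H \<subseteq> F \<Longrightarrow> s \<in> V \<Longrightarrow> finite (reach H s b)"
  using reach_subset finite_V by (rule finite_subset)

lemma card_nbrs_reach_less:
  assumes opt: "optimal H \<tau>" and s: "s \<in> V" "0 < excess H \<tau> s"
    and u: "u \<in> reach H s (\<not> b)" and \<tau>: "\<tau> u = (if b then hi u else lo u)"
  shows "card (nbrs (walk_edges H b) u \<inter> reach H s b) < hi u - lo u"
proof (rule ccontr)
  assume "\<not> ?thesis"
  then obtain X where X: "X \<subseteq> nbrs (walk_edges H b) u \<inter> reach H s b" "card X = hi u - lo u"
    by (meson not_less obtain_subset_with_card_n)
  have HF: "H \<subseteq> F" by (rule valid_subset[OF optimal_valid[OF opt]])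
  have "u \<in> V" using u reach_subset[OF HF s(1)] by blast
  note gap = lo_less_hi[OF this]
  have "X \<noteq> {}" using X(2) gap by auto
  then obtain x where "x \<in> X" by blast
  then obtain n where x: "x \<in> X" "x \<in> layer H s n" and n: "b = even n"
    using X(1) by (auto simp: reach_def)
  have X': "X \<subseteq> nbrs (walk_edges H (even n)) u" using X(1) n by auto
  have deg: "degree (flip H (even n) (star u X)) u
      = (if b then degree H u - (hi u - lo u) else degree H u + (hi u - lo u))"
    using degree_flip_star[OF HF X'] X(2) n by simp
  have blocked: "blocked H \<tau> (\<not> b) u" by (rule reach_blocked[OF opt s u])
  let ?t = "if b then lo u else hi u"
  have "excess H \<tau> u < degree (flip H (even n) (star u X)) u - (?t + 1)"
  proof (rule flip_star_unaffordable[OF opt s all_layers_blocked x X'])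
    show "blocked H \<tau> (even n) y" if "y \<in> X" for y
      using reach_blocked[OF opt s, of y b] X(1) that n by auto
  qed (use blocked \<tau> gap in \<open>auto simp: deg blocked_def\<close>)
  then show False using blocked \<tau> gap by (auto simp: deg blocked_def excess_def split: if_splits)
qed

lemma degree_walk_edges:
  "H \<subseteq> F \<Longrightarrow> degree (walk_edges H False) v + degree (walk_edges H True) v = degree F v"
  using degree_Diff_add[of F H v] simple_graph_finite[OF graph] by (simp add: walk_edges_def)

lemma sum_degree_reach:
  assumes "H \<subseteq> F" "s \<in> V"
  shows "(\<Sum>w\<in>reach H s b. degree (walk_edges H b) w)
    = (\<Sum>u\<in>reach H s (\<not> b). card (nbrs (walk_edges H b) u \<inter> reach H s b))"
proof -
  have "simple_graph V (walk_edges H b)"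
    by (rule simple_graph_subset[OF graph walk_edges_subset[OF assms(1)]])
  then have "(\<Sum>w\<in>reach H s b. degree (walk_edges H b) w)
      = (\<Sum>w\<in>reach H s b. card (nbrs (walk_edges H b) w \<inter> reach H s (\<not> b)))"
    using reach_closed by (intro sum.cong) (auto simp: degree_eq_card_nbrs Int_absorb2)
  also have "\<dots> = (\<Sum>u\<in>reach H s (\<not> b). card (nbrs (walk_edges H b) u \<inter> reach H s b))"
    by (intro sum_card_nbrs_swap finite_reach assms)
  finally show ?thesis .
qed

lemma optimal_excess_eq_0:
  assumes opt: "optimal H \<tau>" and s: "s \<in> V"
  shows "excess H \<tau> s = 0"
proof (rule ccontr)
  assume "excess H \<tau> s \<noteq> 0"
  then have excess: "0 < excess H \<tau> s" by simp
  have val: "valid H \<tau>" by (rule optimal_valid[OF opt])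
  note HF = valid_subset[OF val]
  let ?d = "\<lambda>b. degree (walk_edges H b)" and ?R = "reach H s"
    and ?a = "\<lambda>b v. card (nbrs (walk_edges H b) v \<inter> reach H s b)"
  have a_le: "?a b v \<le> ?d b v" for b v
    using simple_graph_subset[OF graph walk_edges_subset[OF HF], of b]
    by (simp add: degree_eq_card_nbrs card_mono finite_nbrs)
  have split: "?d False v + ?d True v = degree F v" "?d True v = degree H v" for v
    using degree_walk_edges[OF HF] by (auto simp: walk_edges_def)
  have reachD: "v \<in> V" "\<tau> v \<in> {lo v, hi v}" "blocked H \<tau> b v" if "v \<in> ?R b" for v b
    using that reach_subset[OF HF s] val reach_blocked[OF opt s excess that] by (auto simp: valid_def)
  have sparse_odd: "?a True u \<le> ?d False u" if u: "u \<in> ?R False" for u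
    using reachD[OF u] a_le[of True u] split[of u] card_nbrs_reach_less[OF opt s excess, of u True] u
      lo_le_half[of u] gap_le_codegree[of u] lo_less_hi[of u] by (auto simp: blocked_def)
  have sparse_even: "?a False w < ?d True w" if w: "w \<in> ?R True" for w
    using reachD[OF w] a_le[of False w] split[of w] card_nbrs_reach_less[OF opt s excess, of w False] w
      half_le_hi[of w] gap_le_lo[of w] by (auto simp: blocked_def)
  have "s \<in> ?R True" unfolding reach_def by (rule UN_I[of 0]) auto
  then have "(\<Sum>w\<in>?R True. ?a False w) < (\<Sum>w\<in>?R True. ?d True w)"
    using sparse_even by (intro sum_strict_mono finite_reach[OF HF s]) auto
  also have "\<dots> = (\<Sum>u\<in>?R False. ?a True u)" using sum_degree_reach[OF HF s, of True] by simp
  also have "\<dots> \<le> (\<Sum>u\<in>?R False. ?d False u)" by (intro sum_mono sparse_odd)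
  also have "\<dots> = (\<Sum>w\<in>?R True. ?a False w)" using sum_degree_reach[OF HF s, of False] by simp
  finally show False by simp
qed

theorem degree_window_subgraph:
  "\<exists>H\<subseteq>F. \<forall>v\<in>V. degree H v \<in> {lo v, lo v + 1, hi v, hi v + 1}"
proof -
  have "hi v \<le> degree F v" if "v \<in> V" for v
    using gap_le_codegree[OF that] lo_less_hi[OF that] by simp
  then have "valid F hi" by (simp add: valid_def)
  then obtain H \<tau> where opt: "optimal H \<tau>"
    using ex_has_least_nat[of "\<lambda>(H, \<tau>). valid H \<tau>" "(F, hi)" "\<lambda>(H, \<tau>). \<Sum>v\<in>V. excess H \<tau> v"]
    by (auto simp: optimal_def)
  then have val: "valid H \<tau>" by (rule optimal_valid)
  have "degree H v \<in> {lo v, lo v + 1, hi v, hi v + 1}" if v: "v \<in> V" for v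
    using val optimal_excess_eq_0[OF opt v] v by (fastforce simp: valid_def excess_def)
  then show ?thesis using valid_subset[OF val] by blast
qed

end

subsection \<open>Halving and prescribed residues\<close>

definition near_half :: "nat \<Rightarrow> 'a set \<Rightarrow> 'a set set \<Rightarrow> 'a set set \<Rightarrow> bool" where
  "near_half t V E G \<longleftrightarrow>
     (\<forall>v\<in>V. degree E v \<le> 2 * degree G v + t \<and> 2 * degree G v \<le> degree E v + t)"

lemma near_half_Diff:
  assumes "finite E" "G \<subseteq> E" "near_half t V E G"
  shows "near_half t V E (E - G)"
  unfolding near_half_def
proof
  fix v assume "v \<in> V"
  then have "degree E v \<le> 2 * degree G v + t" "2 * degree G v \<le> degree E v + t"
    using assms(3) by (auto simp: near_half_def)
  then show "degree E v \<le> 2 * degree (E - G) v + t \<and> 2 * degree (E - G) v \<le> degree E v + t"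
    using degree_Diff_add[OF assms(1,2), of v] by linarith
qed

corollary near_half_subgraph:
  assumes g: "simple_graph V F" and deg: "\<forall>v\<in>V. 3 \<le> degree F v"
  shows "\<exists>H\<subseteq>F. near_half 4 V F H"
proof -
  interpret degree_windows V F "\<lambda>v. degree F v div 2" "\<lambda>v. degree F v div 2 + 1"
    using deg by unfold_locales (use g in force)+
  obtain H where "H \<subseteq> F" and H: "\<forall>v\<in>V. degree H v \<in>
      {degree F v div 2, degree F v div 2 + 1, degree F v div 2 + 1, degree F v div 2 + 1 + 1}"
    using degree_window_subgraph by blast
  have "near_half 4 V F H"
    unfolding near_half_def
  proof
    fix v assume "v \<in> V"
    then have "degree H v \<in> {degree F v div 2, degree F v div 2 + 1, degree F v div 2 + 2}"
      using H by force
    then show "degree F v \<le> 2 * degree H v + 4 \<and> 2 * degree H v \<le> degree F v + 4" by auto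
  qed
  then show ?thesis using \<open>H \<subseteq> F\<close> by blast
qed

lemma near_half_subgraph_including:
  assumes g: "simple_graph V E" and AB: "A \<subseteq> E" "B \<subseteq> E" "A \<inter> B = {}"
    and few: "\<forall>v\<in>V. degree A v + degree B v \<le> m" and deg: "\<forall>v\<in>V. m + 3 \<le> degree E v"
  shows "\<exists>G\<subseteq>E. A \<subseteq> G \<and> G \<inter> B = {} \<and> near_half (m + 4) V E G"
proof -
  define F where "F = E - (A \<union> B)"
  have gF: "simple_graph V F" by (rule simple_graph_subset[OF g]) (auto simp: F_def)
  have fin: "finite E" "finite A" "finite B" "finite F"
    using simple_graph_finite[OF g] AB by (auto simp: F_def intro: finite_subset)
  have degF: "degree F v + (degree A v + degree B v) = degree E v" for v
    using degree_Diff_add[of E "A \<union> B" v] degree_Un_disjoint[of A B v] fin AB by (simp add: F_def)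
  have "\<forall>v\<in>V. 3 \<le> degree F v"
  proof
    fix v assume v: "v \<in> V"
    show "3 \<le> degree F v" using bspec[OF deg v] bspec[OF few v] degF[of v] by linarith
  qed
  then obtain H where "H \<subseteq> F" and H: "near_half 4 V F H"
    using near_half_subgraph[OF gF] by blast
  have degHA: "degree (H \<union> A) v = degree H v + degree A v" for v
    using \<open>H \<subseteq> F\<close> fin by (intro degree_Un_disjoint) (auto simp: F_def intro: finite_subset)
  have "near_half (m + 4) V E (H \<union> A)"
    unfolding near_half_def
  proof
    fix v assume v: "v \<in> V"
    show "degree E v \<le> 2 * degree (H \<union> A) v + (m + 4)
        \<and> 2 * degree (H \<union> A) v \<le> degree E v + (m + 4)"
      using bspec[OF H[unfolded near_half_def] v] bspec[OF few v] degF[of v] degHA[of v]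
      by linarith
  qed
  moreover have "H \<union> A \<subseteq> E" "(H \<union> A) \<inter> B = {}" using \<open>H \<subseteq> F\<close> AB by (auto simp: F_def)
  ultimately show ?thesis by blast
qed

lemma ex_near_half_in_residue_class:
  fixes d k r :: nat
  assumes "r < k" "8 * k \<le> d"
  shows "\<exists>l p. d + l = 2 * (r + k * p) \<and> l \<le> d div 2 \<and> d div 2 < l + 2 * k"
proof -
  define A p where "A = d + d div 2 - 2 * r" and "p = A div (2 * k)"
  have A: "A = 2 * (k * p) + A mod (2 * k)"
    unfolding p_def using mult_div_mod_eq[of "2 * k" A] by (simp add: mult.assoc)
  have mod_less: "A mod (2 * k) < 2 * k" using assms(1) by simp
  have "A + 2 * r = d + d div 2" "2 * k \<le> d div 2" using assms by (auto simp: A_def)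
  then have "d + (d div 2 - A mod (2 * k)) = 2 * (r + k * p)"
    "d div 2 - A mod (2 * k) \<le> d div 2" "d div 2 < d div 2 - A mod (2 * k) + 2 * k"
    using A mod_less unfolding distrib_left by linarith+
  then show ?thesis by blast
qed

corollary residue_subgraph:
  fixes k r :: "'a \<Rightarrow> nat"
  assumes g: "simple_graph V F"
    and k: "\<forall>v\<in>V. 8 * k v \<le> degree F v" and r: "\<forall>v\<in>V. r v < k v"
  shows "\<exists>H\<subseteq>F. \<forall>v\<in>V. (degree F v + degree H v) div 2 mod k v = r v"
proof -
  have "\<forall>v\<in>V. \<exists>l p. degree F v + l = 2 * (r v + k v * p)
      \<and> l \<le> degree F v div 2 \<and> degree F v div 2 < l + 2 * k v"
    using k r ex_near_half_in_residue_class by blast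
  then obtain lo p where lo: "degree F v + lo v = 2 * (r v + k v * p v)"
    "lo v \<le> degree F v div 2" "degree F v div 2 < lo v + 2 * k v" if "v \<in> V" for v by metis
  have k_bounds: "0 < k v" "8 * k v \<le> degree F v" if "v \<in> V" for v
    using k r that by fastforce+
  interpret degree_windows V F lo "\<lambda>v. lo v + 2 * k v"
    by unfold_locales (use g lo(2,3) k_bounds in fastforce)+
  obtain H where "H \<subseteq> F"
    and H: "\<forall>v\<in>V. degree H v \<in> {lo v, lo v + 1, lo v + 2 * k v, lo v + 2 * k v + 1}"
    using degree_window_subgraph by blast
  have "(degree F v + degree H v) div 2 mod k v = r v" if v: "v \<in> V" for v
  proof -
    have "(degree F v + degree H v) div 2 \<in> {r v + k v * p v, r v + k v * Suc (p v)}"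
      using H lo(1)[OF v] v by auto
    then show ?thesis using r v by (auto simp del: mult_Suc_right)
  qed
  then show ?thesis using \<open>H \<subseteq> F\<close> by blast
qed

lemma weighted_degree_two_on:
  assumes "finite F" "H \<subseteq> F"
  shows "weighted_degree F (\<lambda>e. if e \<in> H then 2 else 1) v = degree F v + degree H v"
proof -
  have "weighted_degree F (\<lambda>e. if e \<in> H then 2 else 1) v
      = (\<Sum>e\<in>{e\<in>F. v \<in> e}. 1 + of_bool (e \<in> H))"
    unfolding weighted_degree_def by (intro sum.cong) auto
  also have "\<dots> = degree F v + card ({e\<in>F. v \<in> e} \<inter> H)"
    using assms by (subst sum.distrib) (simp add: degree_def sum.If_cases of_bool_def)
  also have "{e\<in>F. v \<in> e} \<inter> H = {e\<in>H. v \<in> e}" using assms by auto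
  finally show ?thesis by (simp add: degree_def)
qed

lemma weight_colourable_12_if_residues_differ:
  fixes k r :: "'a \<Rightarrow> nat"
  assumes g: "simple_graph V F"
    and k: "\<forall>v\<in>V. 8 * k v \<le> degree F v" and r: "\<forall>v\<in>V. r v < k v"
    and sep: "\<And>u v. {u, v} \<in> F \<Longrightarrow> (\<exists>m. m dvd k u \<and> m dvd k v \<and> [r u \<noteq> r v] (mod m))
        \<or> 2 * degree F u < degree F v \<or> 2 * degree F v < degree F u"
  shows "weight_colourable_12 V F"
proof -
  obtain H where HF: "H \<subseteq> F" and H: "\<forall>v\<in>V. (degree F v + degree H v) div 2 mod k v = r v"
    using residue_subgraph[OF g k r] by blast
  let ?c = "\<lambda>e. if e \<in> H then 2 else 1 :: nat"
  have fin: "finite F" by (rule simple_graph_finite[OF g])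
  note wd = weighted_degree_two_on[OF fin HF]
  have "weighted_degree F ?c u \<noteq> weighted_degree F ?c v" if uv: "{u, v} \<in> F" for u v
  proof
    assume "weighted_degree F ?c u = weighted_degree F ?c v"
    then have eq: "degree F u + degree H u = degree F v + degree H v" unfolding wd .
    have V: "u \<in> V" "v \<in> V" using simple_graph_edgeD[OF g uv] by auto
    have "\<not> 2 * degree F u < degree F v" "\<not> 2 * degree F v < degree F u"
      using eq degree_mono[OF fin HF, of u] degree_mono[OF fin HF, of v] by linarith+
    then obtain m where m: "m dvd k u" "m dvd k v" "[r u \<noteq> r v] (mod m)"
      using sep[OF uv] by blast
    have "[(degree F w + degree H w) div 2 = r w] (mod m)" if "w \<in> V" "m dvd k w" for w
      using H that by (metis cong_def mod_mod_cancel)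
    then show False using m V eq by (metis cong_sym cong_trans)
  qed
  then show ?thesis unfolding weight_colourable_12_def by (intro exI[of _ ?c]) auto
qed

subsection \<open>Labels with few conflicts\<close>

definition conflict_edges :: "('a \<Rightarrow> nat) \<Rightarrow> 'a set set \<Rightarrow> ('a \<Rightarrow> nat) \<Rightarrow> 'a set set" where
  "conflict_edges k N f = {{u, v} |u v. {u, v} \<in> N \<and> [f u = f v] (mod min (k u) (k v))}"

lemma conflict_edges_subset: "conflict_edges k N f \<subseteq> N"
  by (auto simp: conflict_edges_def)

lemma mem_conflict_edges:
  "{u, v} \<in> conflict_edges k N f \<longleftrightarrow> {u, v} \<in> N \<and> [f u = f v] (mod min (k u) (k v))"
  by (auto simp: conflict_edges_def doubleton_eq_iff min.commute insert_commute intro: cong_sym)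

lemma min_dvd_if_dvd:
  fixes m n :: nat
  assumes "m dvd n \<or> n dvd m" "0 < m" "0 < n"
  shows "min m n dvd m" "min m n dvd n"
  using assms dvd_imp_le[of m n] dvd_imp_le[of n m] by (auto simp: min_def)

text \<open>
  Labels only matter on edges whose ends have comparable degrees: both parts take about half of
  each degree, so at the other edges one weighted degree is larger whatever the weights are.
\<close>

definition comparable_edges :: "'a set set \<Rightarrow> 'a set set" where
  "comparable_edges E = {e\<in>E. \<forall>u\<in>e. \<forall>v\<in>e. degree E u \<le> 4 * degree E v}"

lemma comparable_edges_subset: "comparable_edges E \<subseteq> E"
  by (auto simp: comparable_edges_def)

lemma weight_colourable_12_if_no_conflict:
  fixes k f :: "'a \<Rightarrow> nat"
  assumes g: "simple_graph V E" and GE: "G \<subseteq> E" and half: "near_half t V E G"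
    and t: "\<forall>v\<in>V. 2 * t \<le> degree E v" and k: "\<forall>v\<in>V. 32 * k v \<le> degree E v"
    and chain: "\<forall>u\<in>V. \<forall>v\<in>V. k u dvd k v \<or> k v dvd k u" and f: "\<forall>v\<in>V. f v < k v"
    and no_conflict: "G \<inter> conflict_edges k (comparable_edges E) f = {}"
  shows "weight_colourable_12 V G"
proof (rule weight_colourable_12_if_residues_differ[OF simple_graph_subset[OF g GE] _ f])
  have half': "degree E v \<le> 2 * degree G v + t" "2 * degree G v \<le> degree E v + t"
    and t': "2 * t \<le> degree E v" and k': "32 * k v \<le> degree E v" and pos: "0 < k v"
    if "v \<in> V" for v
    using half t k f that by (fastforce simp: near_half_def)+
  show "\<forall>v\<in>V. 8 * k v \<le> degree G v"
  proof
    fix v assume v: "v \<in> V"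
    show "8 * k v \<le> degree G v" using half'(1)[OF v] t'[OF v] k'[OF v] by linarith
  qed
  fix u v assume uv: "{u, v} \<in> G"
  then have V: "u \<in> V" "v \<in> V" using simple_graph_edgeD[OF g] GE by blast+
  show "(\<exists>m. m dvd k u \<and> m dvd k v \<and> [f u \<noteq> f v] (mod m))
      \<or> 2 * degree G u < degree G v \<or> 2 * degree G v < degree G u"
  proof (cases "{u, v} \<in> comparable_edges E")
    case True
    then have "[f u \<noteq> f v] (mod min (k u) (k v))"
      using uv no_conflict by (auto simp: mem_conflict_edges)
    moreover have "min (k u) (k v) dvd k u" "min (k u) (k v) dvd k v"
      using min_dvd_if_dvd[of "k u" "k v"] chain pos V by simp_all
    ultimately show ?thesis by blast
  next
    case False
    then have "4 * degree E u < degree E v \<or> 4 * degree E v < degree E u"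
      using uv GE by (auto simp: comparable_edges_def)
    then show ?thesis
      using half'[OF V(1)] half'[OF V(2)] t'[OF V(1)] t'[OF V(2)] by linarith
  qed
qed

lemma degree_conflict_edges:
  assumes "simple_graph V N"
  shows "degree (conflict_edges k N f) v
    = (\<Sum>u\<in>nbrs N v. of_bool ([f v = f u] (mod min (k v) (k u))))"
proof -
  have "nbrs (conflict_edges k N f) v = nbrs N v \<inter> {u. [f v = f u] (mod min (k v) (k u))}"
    by (auto simp: nbrs_def mem_conflict_edges)
  then show ?thesis
    using degree_eq_card_nbrs[OF simple_graph_subset[OF assms conflict_edges_subset], of k f v]
      finite_nbrs[OF assms] by (simp add: sum.If_cases of_bool_def)
qed

lemma sum_edges_split_vertex:
  assumes "simple_graph V N"
  shows "(\<Sum>e\<in>N. h e) = (\<Sum>u\<in>nbrs N v. h {v, u}) + (\<Sum>e\<in>{e\<in>N. v \<notin> e}. h e)"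
proof -
  have "(\<Sum>e\<in>N. h e) = (\<Sum>e\<in>{e\<in>N. v \<in> e} \<union> {e\<in>N. v \<notin> e}. h e)"
    by (intro sum.cong) auto
  also have "\<dots> = (\<Sum>e\<in>{e\<in>N. v \<in> e}. h e) + (\<Sum>e\<in>{e\<in>N. v \<notin> e}. h e)"
    using simple_graph_finite[OF assms] by (intro sum.union_disjoint) auto
  also have "(\<Sum>e\<in>{e\<in>N. v \<in> e}. h e) = (\<Sum>u\<in>nbrs N v. h {v, u})"
    by (rule sum.reindex_bij_betw[OF bij_betw_nbrs_incident_edges[OF assms], symmetric])
  finally show ?thesis .
qed

lemma exists_locally_minimal_labelling:
  fixes cost :: "'a \<Rightarrow> 'a \<Rightarrow> 'b \<Rightarrow> 'b \<Rightarrow> nat"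
  assumes g: "simple_graph V N"
    and sym: "\<And>u v a b. cost u v a b = cost v u b a"
    and L: "\<And>v. v \<in> V \<Longrightarrow> L v \<noteq> {}"
  shows "\<exists>f. (\<forall>v\<in>V. f v \<in> L v) \<and> (\<forall>v\<in>V. \<forall>a\<in>L v.
    (\<Sum>u\<in>nbrs N v. cost v u (f v) (f u)) \<le> (\<Sum>u\<in>nbrs N v. cost v u a (f u)))"
proof -
  define edge_cost where "edge_cost f e = (\<Sum>x\<in>e. \<Sum>y\<in>e - {x}. cost x y (f x) (f y))" for f e
  define total where "total f = (\<Sum>e\<in>N. edge_cost f e)" for f
  define local_cost where "local_cost f v = (\<Sum>u\<in>nbrs N v. cost v u (f v) (f u))" for f v
  define rest where "rest f v = (\<Sum>e\<in>{e\<in>N. v \<notin> e}. edge_cost f e)" for f v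
  have total: "total f = 2 * local_cost f v + rest f v" for f v
  proof -
    have "edge_cost f {v, u} = 2 * cost v u (f v) (f u)" if "u \<in> nbrs N v" for u
    proof -
      have "v \<noteq> u" using that simple_graph_edgeD[OF g] by (auto simp: nbrs_def)
      then have "{v, u} - {v} = {u}" "{v, u} - {u} = {v}" by auto
      then show ?thesis using \<open>v \<noteq> u\<close> by (simp add: edge_cost_def sym[of u v])
    qed
    then show ?thesis
      by (simp add: total_def sum_edges_split_vertex[OF g, of _ v] local_cost_def rest_def
          sum_distrib_left)
  qed
  obtain f where f: "\<forall>v\<in>V. f v \<in> L v"
    and least: "\<And>f'. \<forall>v\<in>V. f' v \<in> L v \<Longrightarrow> total f \<le> total f'"
    using ex_has_least_nat[of "\<lambda>f. \<forall>v\<in>V. f v \<in> L v" "\<lambda>v. SOME a. a \<in> L v" total] L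
    by (auto simp: some_in_eq)
  have "(\<Sum>u\<in>nbrs N v. cost v u (f v) (f u)) \<le> (\<Sum>u\<in>nbrs N v. cost v u a (f u))"
    if "v \<in> V" "a \<in> L v" for v a
  proof -
    have "total f \<le> total (f(v := a))" using f that by (intro least) auto
    moreover have "rest (f(v := a)) v = rest f v"
      unfolding rest_def edge_cost_def by (intro sum.cong refl) auto
    ultimately have "local_cost f v \<le> local_cost (f(v := a)) v" using total[of _ v] by simp
    also have "\<dots> = (\<Sum>u\<in>nbrs N v. cost v u a (f u))"
      unfolding local_cost_def using simple_graph_edgeD[OF g]
      by (intro sum.cong) (auto simp: nbrs_def)
    finally show ?thesis by (simp add: local_cost_def)
  qed
  then show ?thesis using f by blast
qed

lemma exists_labelling_cost_le_average:
  fixes cost :: "'a \<Rightarrow> 'a \<Rightarrow> 'b \<Rightarrow> 'b \<Rightarrow> nat"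
  assumes g: "simple_graph V N"
    and sym: "\<And>u v a b. cost u v a b = cost v u b a"
    and L: "\<And>v. v \<in> V \<Longrightarrow> L v \<noteq> {}"
    and B: "\<And>u v b. {v, u} \<in> N \<Longrightarrow> (\<Sum>a\<in>L v. cost v u a b) \<le> B v"
  shows "\<exists>f. (\<forall>v\<in>V. f v \<in> L v) \<and>
    (\<forall>v\<in>V. card (L v) * (\<Sum>u\<in>nbrs N v. cost v u (f v) (f u)) \<le> degree N v * B v)"
proof -
  obtain f where f: "\<forall>v\<in>V. f v \<in> L v"
    and local_min: "\<forall>v\<in>V. \<forall>a\<in>L v.
      (\<Sum>u\<in>nbrs N v. cost v u (f v) (f u)) \<le> (\<Sum>u\<in>nbrs N v. cost v u a (f u))"
    using exists_locally_minimal_labelling[where cost = cost and L = L, OF g sym L] by blast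
  have "card (L v) * (\<Sum>u\<in>nbrs N v. cost v u (f v) (f u)) \<le> degree N v * B v" if "v \<in> V" for v
  proof -
    have "card (L v) * (\<Sum>u\<in>nbrs N v. cost v u (f v) (f u))
        \<le> (\<Sum>a\<in>L v. \<Sum>u\<in>nbrs N v. cost v u a (f u))"
      using local_min that by (intro sum_bounded_below[where 'a = nat, simplified]) auto
    also have "\<dots> = (\<Sum>u\<in>nbrs N v. \<Sum>a\<in>L v. cost v u a (f u))" by (rule sum.swap)
    also have "\<dots> \<le> (\<Sum>u\<in>nbrs N v. B v)" by (intro sum_mono B) (simp add: nbrs_def)
    also have "\<dots> = degree N v * B v" by (simp add: degree_eq_card_nbrs[OF g])
    finally show ?thesis .
  qed
  then show ?thesis using f by blast
qed

lemma card_cong_le: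
  fixes m n q b :: nat
  assumes "m dvd n" "n \<le> q * m" "0 < n"
  shows "card {a \<in> {..<n}. [a = b] (mod m)} \<le> q"
proof -
  have m: "0 < m" using assms dvd_pos_nat by blast
  have "card {a \<in> {..<n}. [a = b] (mod m)} \<le> card {..<q}"
  proof (rule card_inj_on_le)
    show "inj_on (\<lambda>a. a div m) {a \<in> {..<n}. [a = b] (mod m)}"
      by (rule inj_onI) (metis (no_types, lifting) cong_def div_mult_mod_eq mem_Collect_eq)
    show "(\<lambda>a. a div m) ` {a \<in> {..<n}. [a = b] (mod m)} \<subseteq> {..<q}"
      using assms(2) by (auto simp: less_mult_imp_div_less)
  qed simp
  then show ?thesis by simp
qed

text \<open>
  The labels of a vertex are pairs, one component for each part. A random pair meets each of the
  two components with probability at most \<open>q / n\<close>, but both of them only with probability at most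
  \<open>(q / n)\<^sup>2\<close>, so that a double conflict can be made expensive.
\<close>

definition conflict_cost :: "nat \<Rightarrow> nat \<Rightarrow> nat \<times> nat \<Rightarrow> nat \<times> nat \<Rightarrow> nat" where
  "conflict_cost M m p p' =
     of_bool ([fst p = fst p'] (mod m)) + of_bool ([snd p = snd p'] (mod m))
     + M * (of_bool ([fst p = fst p'] (mod m)) * of_bool ([snd p = snd p'] (mod m)))"

lemma conflict_cost_sym: "conflict_cost M m p p' = conflict_cost M m p' p"
  by (simp add: conflict_cost_def cong_sym_eq)

lemma sum_conflict_cost_le:
  assumes "m dvd n" "n \<le> q * m" "0 < n"
  shows "(\<Sum>p\<in>{..<n} \<times> {..<n}. conflict_cost M m p p') \<le> 2 * (n * q) + M * (q * q)"
proof -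
  define P where "P c = (\<Sum>a<n. of_bool ([a = c] (mod m)) :: nat)" for c
  have P: "P c \<le> q" for c
    using card_cong_le[OF assms, of c] by (simp add: P_def sum.If_cases of_bool_def Int_def)
  have "(\<Sum>p\<in>{..<n} \<times> {..<n}. conflict_cost M m p p')
      = n * P (fst p') + n * P (snd p') + M * (P (fst p') * P (snd p'))"
    unfolding P_def conflict_cost_def sum.cartesian_product'
    by (simp del: sum_of_bool_eq
        add: sum.distrib sum_distrib_left[symmetric] sum_distrib_right[symmetric])
  also have "\<dots> \<le> n * q + n * q + M * (q * q)"
    by (intro add_mono mult_le_mono order_refl P)
  finally show ?thesis by simp
qed

lemma exists_pair_labels_cost_le:
  fixes k :: "'a \<Rightarrow> nat" and D q :: nat
  assumes g: "simple_graph V N"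
    and deg: "\<forall>v\<in>V. degree N v \<le> D * k v"
    and k: "\<forall>v\<in>V. 0 < k v" "\<forall>v\<in>V. 2 * D * q\<^sup>2 \<le> k v"
    and min_k: "\<And>u v. {u, v} \<in> N \<Longrightarrow>
      min (k u) (k v) dvd k u \<and> k u \<le> q * min (k u) (k v)"
  defines "M \<equiv> 4 * D * q"
  shows "\<exists>f. (\<forall>v\<in>V. f v \<in> {..<k v} \<times> {..<k v})
    \<and> (\<forall>v\<in>V. (\<Sum>u\<in>nbrs N v. conflict_cost M (min (k v) (k u)) (f v) (f u)) \<le> M)"
proof -
  define cost where "cost u v = conflict_cost M (min (k u) (k v))" for u v
  have cost_sym: "cost u v p p' = cost v u p' p" for u v p p'
    by (simp add: cost_def conflict_cost_sym min.commute)
  have sum_cost_le: "(\<Sum>p\<in>{..<k v} \<times> {..<k v}. cost v u p p') \<le> 2 * (k v * q) + M * (q * q)"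
    if "{v, u} \<in> N" for u v p'
    unfolding cost_def
    using min_k[OF that] k(1) simple_graph_edgeD[OF g that] by (intro sum_conflict_cost_le) auto
  have "{..<k v} \<times> {..<k v} \<noteq> {}" if "v \<in> V" for v using k(1) that by auto
  then obtain f where f: "\<forall>v\<in>V. f v \<in> {..<k v} \<times> {..<k v}"
    and average: "\<forall>v\<in>V. card ({..<k v} \<times> {..<k v}) * (\<Sum>u\<in>nbrs N v. cost v u (f v) (f u))
      \<le> degree N v * (2 * (k v * q) + M * (q * q))"
    using exists_labelling_cost_le_average[where cost = cost and L = "\<lambda>v. {..<k v} \<times> {..<k v}",
        OF g cost_sym _ sum_cost_le] by blast
  have "(\<Sum>u\<in>nbrs N v. cost v u (f v) (f u)) \<le> M" (is "?S \<le> M") if v: "v \<in> V" for v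
  proof -
    have "k v * (k v * ?S) = card ({..<k v} \<times> {..<k v}) * ?S" by (simp add: card_cartesian_product)
    also have "\<dots> \<le> degree N v * (2 * (k v * q) + M * (q * q))" using average v by blast
    also have "\<dots> \<le> D * k v * (2 * (k v * q) + M * (q * q))" using deg v by (intro mult_le_mono) auto
    also have "\<dots> = k v * (2 * D * q * k v + 2 * D * q * (2 * D * q\<^sup>2))"
      by (simp add: M_def algebra_simps power2_eq_square)
    also have "\<dots> \<le> k v * (2 * D * q * k v + 2 * D * q * k v)"
      using k(2) v by (intro mult_le_mono add_mono) auto
    also have "\<dots> = k v * (k v * M)" by (simp add: M_def)
    finally show ?thesis using k(1) v by simp
  qed
  then show ?thesis using f unfolding cost_def by blast
qed

lemma exists_labels_few_conflicts:
  fixes k :: "'a \<Rightarrow> nat" and D q :: nat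
  assumes g: "simple_graph V N"
    and deg: "\<forall>v\<in>V. degree N v \<le> D * k v"
    and k: "\<forall>v\<in>V. 0 < k v" "\<forall>v\<in>V. 2 * D * q\<^sup>2 \<le> k v"
    and min_k: "\<And>u v. {u, v} \<in> N \<Longrightarrow>
      min (k u) (k v) dvd k u \<and> k u \<le> q * min (k u) (k v)"
  shows "\<exists>r s. (\<forall>v\<in>V. r v < k v) \<and> (\<forall>v\<in>V. s v < k v)
    \<and> conflict_edges k N r \<inter> conflict_edges k N s = {}
    \<and> (\<forall>v\<in>V. degree (conflict_edges k N r) v + degree (conflict_edges k N s) v \<le> 4 * D * q)"
proof -
  define M where "M = 4 * D * q"
  let ?cost = "\<lambda>f v u. conflict_cost M (min (k v) (k u)) (f v) (f u)"
  obtain f where f: "\<forall>v\<in>V. f v \<in> {..<k v} \<times> {..<k v}"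
    and cost_le: "\<forall>v\<in>V. (\<Sum>u\<in>nbrs N v. ?cost f v u) \<le> M"
    using exists_pair_labels_cost_le[OF g deg k min_k] unfolding M_def by blast
  let ?R = "conflict_edges k N (\<lambda>v. fst (f v))" and ?S = "conflict_edges k N (\<lambda>v. snd (f v))"
  have "?R \<inter> ?S = {}"
  proof (rule ccontr)
    assume "\<not> ?thesis"
    then obtain e where e: "e \<in> ?R" "e \<in> ?S" by blast
    then have "e \<in> N" using conflict_edges_subset by blast
    then obtain u v where uv: "e = {u, v}" "{u, v} \<in> N" using simple_graph_edgeE[OF g] by metis
    have "M < ?cost f u v"
      using e unfolding uv(1) mem_conflict_edges by (simp add: conflict_cost_def)
    also have "\<dots> \<le> (\<Sum>w\<in>nbrs N u. ?cost f u w)"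
      using uv(2) finite_nbrs[OF g] by (intro member_le_sum) (auto simp: nbrs_def)
    also have "\<dots> \<le> M" using cost_le simple_graph_edgeD[OF g uv(2)] by blast
    finally show False by simp
  qed
  moreover have "degree ?R v + degree ?S v \<le> M" if v: "v \<in> V" for v
  proof -
    have "degree ?R v + degree ?S v \<le> (\<Sum>u\<in>nbrs N v. ?cost f v u)"
      unfolding degree_conflict_edges[OF g] sum.distrib[symmetric]
      by (intro sum_mono) (simp add: conflict_cost_def)
    also have "\<dots> \<le> M" using cost_le v by blast
    finally show ?thesis .
  qed
  moreover have "\<forall>v\<in>V. fst (f v) < k v" "\<forall>v\<in>V. snd (f v) < k v"
    using f by (auto simp: mem_Times_iff)
  ultimately show ?thesis unfolding M_def
    by (intro exI[of _ "\<lambda>v. fst (f v)"] exI[of _ "\<lambda>v. snd (f v)"]) blast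
qed

subsection \<open>The decomposition\<close>

lemma ex_dyadic_moduli:
  fixes d :: "'a \<Rightarrow> nat"
  assumes c: "0 < c" "\<forall>v\<in>V. c \<le> d v"
  shows "\<exists>k. (\<forall>v\<in>V. 0 < k v \<and> c * k v \<le> d v \<and> d v \<le> 2 * c * k v)
    \<and> (\<forall>u\<in>V. \<forall>v\<in>V. k u dvd k v \<or> k v dvd (k u :: nat))"
proof -
  have "\<exists>j. 2 ^ j \<le> d v div c \<and> d v div c < 2 ^ (j + 1)" if "v \<in> V" for v
    using c that by (intro ex_power_ivl1) (auto simp: Suc_le_eq div_greater_zero_iff)
  then obtain j where j: "\<And>v. v \<in> V \<Longrightarrow> 2 ^ j v \<le> d v div c \<and> d v div c < 2 ^ (j v + 1)"
    by metis
  have "c * 2 ^ j v \<le> d v" "d v \<le> 2 * c * 2 ^ j v" if "v \<in> V" for v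
    using j[OF that] c(1) by (auto simp: less_eq_div_iff_mult_less_eq div_less_iff_less_mult ac_simps)
  moreover have "(2 :: nat) ^ m dvd 2 ^ n \<or> (2 :: nat) ^ n dvd 2 ^ m" for m n
    using le_imp_power_dvd nat_le_linear by blast
  ultimately show ?thesis by (intro exI[of _ "\<lambda>v. 2 ^ j v"]) auto
qed

lemma exists_labels_comparable_edges:
  fixes k :: "'a \<Rightarrow> nat"
  assumes g: "simple_graph V E" and c: "0 < c"
    and k: "\<forall>v\<in>V. 0 < k v \<and> c * k v \<le> degree E v \<and> degree E v \<le> 2 * c * k v"
    and chain: "\<forall>u\<in>V. \<forall>v\<in>V. k u dvd k v \<or> k v dvd k u"
    and large: "\<forall>v\<in>V. 256 * c \<le> k v"
  defines "N \<equiv> comparable_edges E"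
  shows "\<exists>r s. (\<forall>v\<in>V. r v < k v) \<and> (\<forall>v\<in>V. s v < k v)
    \<and> conflict_edges k N r \<inter> conflict_edges k N s = {}
    \<and> (\<forall>v\<in>V. degree (conflict_edges k N r) v + degree (conflict_edges k N s) v \<le> 64 * c)"
proof -
  have NE: "N \<subseteq> E" unfolding N_def by (rule comparable_edges_subset)
  have gN: "simple_graph V N" by (rule simple_graph_subset[OF g NE])
  have "degree N v \<le> 2 * c * k v" if "v \<in> V" for v
    using degree_mono[OF simple_graph_finite[OF g] NE, of v] k that by fastforce
  moreover have "min (k u) (k v) dvd k u \<and> k u \<le> 8 * min (k u) (k v)" if "{u, v} \<in> N" for u v
  proof -
    have V: "u \<in> V" "v \<in> V" using simple_graph_edgeD[OF gN that] by auto
    have "degree E u \<le> 4 * degree E v" using that by (auto simp: N_def comparable_edges_def)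
    then have "c * k u \<le> c * (8 * k v)" using bspec[OF k V(1)] bspec[OF k V(2)] by linarith
    then have "k u \<le> 8 * min (k u) (k v)" using c by (simp add: min_def)
    then show ?thesis using min_dvd_if_dvd(1) chain k V by simp
  qed
  ultimately show ?thesis
    using exists_labels_few_conflicts[OF gN, of "2 * c" k 8] k large by simp
qed

theorem theorem6:
  fixes V :: "'a set" and E :: "'a set set"
  assumes "simple_graph V E"
    and "\<forall>v\<in>V. degree E v \<ge> 10^6"
  shows "\<exists>E1 E2. E1 \<union> E2 = E \<and> E1 \<inter> E2 = {} \<and>
           weight_colourable_12 V E1 \<and> weight_colourable_12 V E2"
proof -
  note g = assms(1)
  obtain k where k: "\<forall>v\<in>V. 0 < k v \<and> 32 * k v \<le> degree E v \<and> degree E v \<le> 2 * 32 * k v"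
    and chain: "\<forall>u\<in>V. \<forall>v\<in>V. k u dvd k v \<or> k v dvd k u"
    using ex_dyadic_moduli[of 32 V "degree E"] assms(2) by fastforce
  have large: "\<forall>v\<in>V. 256 * 32 \<le> k v" using k assms(2) by fastforce
  let ?C = "conflict_edges k (comparable_edges E)"
  obtain r s where r: "\<forall>v\<in>V. r v < k v" and s: "\<forall>v\<in>V. s v < k v"
    and disj: "?C r \<inter> ?C s = {}" and few: "\<forall>v\<in>V. degree (?C r) v + degree (?C s) v \<le> 64 * 32"
    using exists_labels_comparable_edges[OF g _ k chain large] by auto
  have "?C f \<subseteq> E" for f using conflict_edges_subset comparable_edges_subset by blast
  then obtain G where G: "G \<subseteq> E" "?C r \<subseteq> G" "G \<inter> ?C s = {}" and half: "near_half 2052 V E G"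
    using near_half_subgraph_including[OF g _ _ disj few] assms(2) by fastforce
  have colourable: "weight_colourable_12 V H"
    if "H \<subseteq> E" "near_half 2052 V E H" "\<forall>v\<in>V. f v < k v" "H \<inter> ?C f = {}" for H f
    using that k chain assms(2)
    by (intro weight_colourable_12_if_no_conflict[OF g, of H 2052 k f]) auto
  have "weight_colourable_12 V G" using colourable[OF G(1) half s G(3)] .
  moreover have "weight_colourable_12 V (E - G)"
    using near_half_Diff[OF simple_graph_finite[OF g] G(1) half] G(2)
    by (intro colourable[OF _ _ r]) auto
  ultimately show ?thesis using G(1) by (intro exI[of _ G] exI[of _ "E - G"]) auto
qed

end
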